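(* For every sequent $\Gamma\Rightarrow\delta$ of first-order arithmetic: if $\mathrm{SHA}\vdash\Gamma\Rightarrow\delta$ then $\mathrm{HA}\vdash\Gamma\Rightarrow\delta$.
   Context: Language: terms from variables, $0,S,+,\cdot$; formulas from $s=t,\bot,\wedge,\vee,\to,\forall,\exists$. $\mathrm{HA}$-sequents $\Gamma\Rightarrow\delta$: finite set $\Gamma$, single formula $\delta$. $\mathrm{HA}$: sequent calculus (finite tree proofs) with the standard intuitionistic rules Ax ($\Gamma,\delta\Rightarrow\delta$), $\to$L/R, $\wedge$L/R, $\vee$L/R, $\forall$L/R, $\exists$L/R (usual eigenvariable conditions), $\bot$L, $=$L (from $\Gamma[x/y]\Rightarrow\delta[x/y]$ infer $\Gamma[s/x,t/y],s=t\Rightarrow\delta[s/x,t/y]$, $x,y\notin\mathrm{FV}(s,t)$), $=$R ($\Gamma\Rightarrow t=t$), weakening, cut, arithmetic axioms $\Rightarrow 0\neq St$, $Ss=St\Rightarrow s=t$, $\Rightarrow s+0=s$, $\Rightarrow s+St=S(s+t)$, $\Rightarrow s\cdot0=0$, $\Rightarrow s\cdot St=(s\cdot t)+s$, and induction axioms $\varphi(0),\forall x.\,\varphi(x)\to\varphi(Sx)\Rightarrow\varphi(s)$. $\mathrm{SHA}$ (stack-labelled Heyting arithmetic): a companion label is $x^\bullet\mapsto\Gamma\Rightarrow\delta$ with $\Gamma\Rightarrow\delta$ an $\mathrm{HA}$-sequent, $x\in\mathrm{FV}(\Gamma,\delta)$, $x^\bullet\in\{x^+,x^-\}$. A stack $\Lambda$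 is a finite list of labels ($\Lambda;\ell$ appends $\ell$ last; $\varepsilon$ is empty); $\textsc{Var}(\Lambda)$ is the set of variables of its labels; $\Lambda^{+x}$ replaces every $x^-$ in $\Lambda$ by $x^+$. $\mathrm{SHA}$-sequents are $\Lambda\mid\Gamma\Rightarrow\delta$, well-formed if every variable of $\textsc{Var}(\Lambda)$ is free in $\Gamma,\delta$. Rules: (i) every logical rule of $\mathrm{HA}$ above (including weakening, cut, $=$L, $=$R, $\bot$L) with the same stack in conclusion and premises, the eigenvariable of $\forall$R/$\exists$L also not occurring in $\Lambda$; (ii) Ax and the arithmetic axioms only with empty stack ($\varepsilon\mid\Gamma,\delta\Rightarrow\delta$, $\varepsilon\mid\Gamma\Rightarrow0\neq St$, $\varepsilon\mid\Gamma,Ss=St\Rightarrow s=t$, etc.); (iii) Comp (from $\Lambda;(x^-\mapsto\Gamma\Rightarrow\delta)\mid\Gamma\Rightarrow\delta$ infer $\Lambda\mid\Gamma\Rightarrow\delta$), Bud (axiom $\Lambda;(x^+\mapsto\Gamma\Rightarrow\delta)\mid\Gamma\Rightarrow\delta$), Pop (from $\Lambda\mid\Gamma\Rightarrow\delta$ infer $\Lambda;\Lambda'\mid\Gamma\Rightarrow\delta$), $\textsc{Case}_x$ (from $\Lambda\mid\Gamma[0/x]\Rightarrow\delta[0/x]$ and $\Lambda^{+x}\mid\Gamma[Sx/x]\Rightarrow\delta[Sx/x]$ infer $\Lambda\mid\Gamma\Rightarrow\delta$). Proofs are finite trees; every rule except Pop may only derive well-formed sequents. $\mathrm{SHA}\vdash\Gamma\Rightarrow\delta$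 means there is a proof of $\varepsilon\mid\Gamma\Rightarrow\delta$. *)

theory Defs
  imports Main "HOL-Library.FSet"
begin

text \<open>
  Formulas are taken up to renaming of bound variables, by de Bruijn indices. Free variables
  are natural numbers: \<open>Var n\<close> under \<open>k\<close> quantifiers is the free variable \<open>n - k\<close> if
  \<open>n \<ge> k\<close>, and is bound otherwise. So at top level \<open>Var n\<close> is simply the variable named \<open>n\<close>, and
  every element of the datatype is a legitimate formula.
\<close>

datatype tm = Var nat | Zero | Succ tm | Add tm tm | Mul tm tm

datatype fm =
    Eq tm tm
  | Bot
  | And fm fm
  | Or fm fm
  | Imp fm fm
  | All fm
  | Ex fm

abbreviation Neg :: "fm \<Rightarrow> fm" where
  "Neg \<phi> \<equiv> Imp \<phi> Bot"

primrec fv_tm :: "tm \<Rightarrow> nat set" where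
  "fv_tm (Var n) = {n}"
| "fv_tm Zero = {}"
| "fv_tm (Succ t) = fv_tm t"
| "fv_tm (Add s t) = fv_tm s \<union> fv_tm t"
| "fv_tm (Mul s t) = fv_tm s \<union> fv_tm t"

primrec fv :: "fm \<Rightarrow> nat set" where
  "fv (Eq s t) = fv_tm s \<union> fv_tm t"
| "fv Bot = {}"
| "fv (And \<phi> \<psi>) = fv \<phi> \<union> fv \<psi>"
| "fv (Or \<phi> \<psi>) = fv \<phi> \<union> fv \<psi>"
| "fv (Imp \<phi> \<psi>) = fv \<phi> \<union> fv \<psi>"
| "fv (All \<phi>) = {n. Suc n \<in> fv \<phi>}"
| "fv (Ex \<phi>) = {n. Suc n \<in> fv \<phi>}"

text \<open>Simultaneous capture-avoiding substitution.\<close>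

primrec subst_tm :: "tm \<Rightarrow> (nat \<Rightarrow> tm) \<Rightarrow> tm" where
  "subst_tm (Var n) \<sigma> = \<sigma> n"
| "subst_tm Zero \<sigma> = Zero"
| "subst_tm (Succ t) \<sigma> = Succ (subst_tm t \<sigma>)"
| "subst_tm (Add s t) \<sigma> = Add (subst_tm s \<sigma>) (subst_tm t \<sigma>)"
| "subst_tm (Mul s t) \<sigma> = Mul (subst_tm s \<sigma>) (subst_tm t \<sigma>)"

definition up :: "(nat \<Rightarrow> tm) \<Rightarrow> nat \<Rightarrow> tm" where
  "up \<sigma> = case_nat (Var 0) (\<lambda>n. subst_tm (\<sigma> n) (\<lambda>m. Var (Suc m)))"

primrec subst :: "fm \<Rightarrow> (nat \<Rightarrow> tm) \<Rightarrow> fm" where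
  "subst (Eq s t) \<sigma> = Eq (subst_tm s \<sigma>) (subst_tm t \<sigma>)"
| "subst Bot \<sigma> = Bot"
| "subst (And \<phi> \<psi>) \<sigma> = And (subst \<phi> \<sigma>) (subst \<psi> \<sigma>)"
| "subst (Or \<phi> \<psi>) \<sigma> = Or (subst \<phi> \<sigma>) (subst \<psi> \<sigma>)"
| "subst (Imp \<phi> \<psi>) \<sigma> = Imp (subst \<phi> \<sigma>) (subst \<psi> \<sigma>)"
| "subst (All \<phi>) \<sigma> = All (subst \<phi> (up \<sigma>))"
| "subst (Ex \<phi>) \<sigma> = Ex (subst \<phi> (up \<sigma>))"

text \<open>
  \<open>inst \<phi> t\<close> is \<open>\<phi>(t)\<close> for the body \<open>\<phi>\<close> of a quantifier: index \<open>0\<close> becomes \<open>t\<close> and the remaining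
  indices move down by one. In contrast, \<open>subst \<phi> (Var(x := t))\<close> is \<open>\<phi>[t/x]\<close> for a free
  variable \<open>x\<close>, all other variables keeping their names.
\<close>

definition inst :: "fm \<Rightarrow> tm \<Rightarrow> fm" where
  "inst \<phi> t = subst \<phi> (case_nat t Var)"

datatype sequent = Sequent (ant: "fm fset") (con: fm)  (infix "\<leadsto>" 50)

definition FV :: "sequent \<Rightarrow> nat set" where
  "FV c = (\<Union>\<phi>\<in>fset (ant c). fv \<phi>) \<union> fv (con c)"

definition subst_seq :: "sequent \<Rightarrow> (nat \<Rightarrow> tm) \<Rightarrow> sequent" where
  "subst_seq c \<sigma> = ((\<lambda>\<phi>. subst \<phi> \<sigma>) |`| ant c \<leadsto> subst (con c) \<sigma>)"

text \<open>
  \<open>logical ps E c\<close>: the sequent \<open>c\<close> follows from the premises \<open>ps\<close> by a logical rule whose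
  eigenvariables form the set \<open>E\<close> (empty or a singleton). Since antecedents are sets,
  \<open>finsert \<phi> \<Gamma>\<close> does not exclude \<open>\<phi> |\<in>| \<Gamma>\<close>, so contraction is built in.
\<close>

inductive logical :: "sequent list \<Rightarrow> nat set \<Rightarrow> sequent \<Rightarrow> bool" where
  ImpL: "logical [\<Gamma> \<leadsto> \<phi>, finsert \<psi> \<Gamma> \<leadsto> \<delta>] {} (finsert (Imp \<phi> \<psi>) \<Gamma> \<leadsto> \<delta>)"
| ImpR: "logical [finsert \<phi> \<Gamma> \<leadsto> \<psi>] {} (\<Gamma> \<leadsto> Imp \<phi> \<psi>)"
| AndL: "logical [finsert \<phi> (finsert \<psi> \<Gamma>) \<leadsto> \<delta>] {} (finsert (And \<phi> \<psi>) \<Gamma> \<leadsto> \<delta>)"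
| AndR: "logical [\<Gamma> \<leadsto> \<phi>, \<Gamma> \<leadsto> \<psi>] {} (\<Gamma> \<leadsto> And \<phi> \<psi>)"
| OrL: "logical [finsert \<phi> \<Gamma> \<leadsto> \<delta>, finsert \<psi> \<Gamma> \<leadsto> \<delta>] {} (finsert (Or \<phi> \<psi>) \<Gamma> \<leadsto> \<delta>)"
| OrR1: "logical [\<Gamma> \<leadsto> \<phi>] {} (\<Gamma> \<leadsto> Or \<phi> \<psi>)"
| OrR2: "logical [\<Gamma> \<leadsto> \<psi>] {} (\<Gamma> \<leadsto> Or \<phi> \<psi>)"
| AllL: "logical [finsert (inst \<phi> t) \<Gamma> \<leadsto> \<delta>] {} (finsert (All \<phi>) \<Gamma> \<leadsto> \<delta>)"
| AllR: "y \<notin> FV (\<Gamma> \<leadsto> All \<phi>)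
    \<Longrightarrow> logical [\<Gamma> \<leadsto> inst \<phi> (Var y)] {y} (\<Gamma> \<leadsto> All \<phi>)"
| ExL: "y \<notin> FV (finsert (Ex \<phi>) \<Gamma> \<leadsto> \<delta>)
    \<Longrightarrow> logical [finsert (inst \<phi> (Var y)) \<Gamma> \<leadsto> \<delta>] {y} (finsert (Ex \<phi>) \<Gamma> \<leadsto> \<delta>)"
| ExR: "logical [\<Gamma> \<leadsto> inst \<phi> t] {} (\<Gamma> \<leadsto> Ex \<phi>)"
| BotL: "logical [] {} (finsert Bot \<Gamma> \<leadsto> \<delta>)"
| EqL: "x \<noteq> y \<Longrightarrow> x \<notin> fv_tm s \<union> fv_tm t \<Longrightarrow> y \<notin> fv_tm s \<union> fv_tm t
    \<Longrightarrow> subst_seq (\<Gamma> \<leadsto> \<delta>) (Var(x := s, y := t)) = (\<Gamma>' \<leadsto> \<delta>')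
    \<Longrightarrow> logical [subst_seq (\<Gamma> \<leadsto> \<delta>) (Var(y := Var x))] {} (finsert (Eq s t) \<Gamma>' \<leadsto> \<delta>')"
| EqR: "logical [] {} (\<Gamma> \<leadsto> Eq t t)"
| Wk: "logical [\<Gamma> \<leadsto> \<delta>] {} (\<Gamma> |\<union>| \<Gamma>' \<leadsto> \<delta>)"
| Cut: "logical [\<Gamma> \<leadsto> \<phi>, finsert \<phi> \<Gamma> \<leadsto> \<delta>] {} (\<Gamma> \<leadsto> \<delta>)"

inductive arith_axiom :: "sequent \<Rightarrow> bool" where
  "arith_axiom ({||} \<leadsto> Neg (Eq Zero (Succ t)))"
| "arith_axiom ({|Eq (Succ s) (Succ t)|} \<leadsto> Eq s t)"
| "arith_axiom ({||} \<leadsto> Eq (Add s Zero) s)"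
| "arith_axiom ({||} \<leadsto> Eq (Add s (Succ t)) (Succ (Add s t)))"
| "arith_axiom ({||} \<leadsto> Eq (Mul s Zero) Zero)"
| "arith_axiom ({||} \<leadsto> Eq (Mul s (Succ t)) (Add (Mul s t) s))"

text \<open>
  In the induction axiom \<open>\<phi>\<close> is a quantifier body. Under the quantifier the bound variable
  is \<open>Var 0\<close>, so \<open>\<phi>(x)\<close> is \<open>\<phi>\<close> itself and \<open>\<phi>(Sx)\<close> is \<open>subst \<phi> (Var(0 := Succ (Var 0)))\<close>.
\<close>

inductive HA :: "sequent \<Rightarrow> bool" where
  Ax: "HA (finsert \<delta> \<Gamma> \<leadsto> \<delta>)"
| Logical: "logical ps E c \<Longrightarrow> \<forall>p\<in>set ps. HA p \<Longrightarrow> HA c"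
| Arith: "arith_axiom c \<Longrightarrow> HA c"
| Induction: "HA ({|inst \<phi> Zero, All (Imp \<phi> (subst \<phi> (Var(0 := Succ (Var 0)))))|} \<leadsto> inst \<phi> s)"

datatype polarity = Plus | Minus

datatype label = Label (lvar: nat) (lpol: polarity) (lseq: sequent)

text \<open>The end of the list is the top of the stack.\<close>

type_synonym stack = "label list"

definition is_stack :: "stack \<Rightarrow> bool" where
  "is_stack \<Lambda> \<longleftrightarrow> (\<forall>l\<in>set \<Lambda>. lvar l \<in> FV (lseq l))"

definition Vars :: "stack \<Rightarrow> nat set" where
  "Vars \<Lambda> = lvar ` set \<Lambda>"

definition occurring :: "stack \<Rightarrow> nat set" where
  "occurring \<Lambda> = (\<Union>l\<in>set \<Lambda>. insert (lvar l) (FV (lseq l)))"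

definition plus_at :: "nat \<Rightarrow> stack \<Rightarrow> stack" where
  "plus_at x = map (\<lambda>l. if lvar l = x then Label x Plus (lseq l) else l)"

definition well_formed :: "stack \<Rightarrow> sequent \<Rightarrow> bool" where
  "well_formed \<Lambda> c \<longleftrightarrow> is_stack \<Lambda> \<and> Vars \<Lambda> \<subseteq> FV c"

text \<open>
  \<open>SHA \<Lambda> c\<close> is derivability of \<open>\<Lambda> | c\<close>. Sequents with empty stack are trivially well-formed.
  The conclusion of \<open>Pop\<close> need not be well-formed, but its stack still has to consist
  of companion labels.
\<close>

inductive SHA :: "stack \<Rightarrow> sequent \<Rightarrow> bool" where
  Logical: "logical ps E c \<Longrightarrow> E \<inter> occurring \<Lambda> = {} \<Longrightarrow> \<forall>p\<in>set ps. SHA \<Lambda> p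
    \<Longrightarrow> well_formed \<Lambda> c \<Longrightarrow> SHA \<Lambda> c"
| Ax: "SHA [] (finsert \<delta> \<Gamma> \<leadsto> \<delta>)"
| Arith: "arith_axiom (\<Gamma> \<leadsto> \<delta>) \<Longrightarrow> SHA [] (\<Gamma> |\<union>| \<Gamma>' \<leadsto> \<delta>)"
| Comp: "SHA (\<Lambda> @ [Label x Minus c]) c \<Longrightarrow> x \<in> FV c \<Longrightarrow> well_formed \<Lambda> c \<Longrightarrow> SHA \<Lambda> c"
| Bud: "well_formed (\<Lambda> @ [Label x Plus c]) c \<Longrightarrow> SHA (\<Lambda> @ [Label x Plus c]) c"
| Pop: "SHA \<Lambda> c \<Longrightarrow> is_stack \<Lambda>' \<Longrightarrow> SHA (\<Lambda> @ \<Lambda>') c"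
| Case: "SHA \<Lambda> (subst_seq c (Var(x := Zero)))
    \<Longrightarrow> SHA (plus_at x \<Lambda>) (subst_seq c (Var(x := Succ (Var x))))
    \<Longrightarrow> well_formed \<Lambda> c \<Longrightarrow> SHA \<Lambda> c"

end

theory Submission
  imports Defs
begin

text \<open>
  A label whose companion sequent \<open>c\<close> is tracked by \<open>x\<close> is read as an induction hypothesis
  \<open>\<forall>z < x. \<psi>(z)\<close> if it is negative and \<open>\<forall>z < Sx. \<psi>(z)\<close> if it is positive. Here \<open>\<psi>\<close>
  is any formula in one variable such that \<open>\<psi>(x)\<close>, together with the hypotheses of the labels
  further down the stack, proves \<open>c\<close>. This requirement survives when labels further down become
  positive, because their hypotheses only get stronger; hence every rule of \<open>SHA\<close> preserves
  derivability from the hypotheses. At a companion we choose for \<open>\<psi>\<close> the universal closure, except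
  for \<open>x\<close>, of the implication from the current hypotheses to the companion sequent, and discharge
  the new hypothesis by strong induction on \<open>x\<close>.
\<close>

section \<open>Substitution\<close>

lemma subst_tm_subst_tm: "subst_tm (subst_tm t \<sigma>) \<tau> = subst_tm t (\<lambda>n. subst_tm (\<sigma> n) \<tau>)"
  by (induction t) auto

lemma subst_tm_cong: "(\<And>n. n \<in> fv_tm t \<Longrightarrow> \<sigma> n = \<tau> n) \<Longrightarrow> subst_tm t \<sigma> = subst_tm t \<tau>"
  by (induction t) auto

lemma subst_tm_Var [simp]: "subst_tm t Var = t"
  by (induction t) auto

lemma subst_tm_fresh: "x \<notin> fv_tm t \<Longrightarrow> subst_tm t (Var(x := u)) = t"
  by (induction t) auto

lemma fv_subst_tm: "fv_tm (subst_tm t \<sigma>) = (\<Union>n\<in>fv_tm t. fv_tm (\<sigma> n))"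
  by (induction t) auto

lemma up_simps [simp]:
  "up \<sigma> 0 = Var 0"
  "up \<sigma> (Suc n) = subst_tm (\<sigma> n) (\<lambda>m. Var (Suc m))"
  by (simp_all add: up_def)

lemma up_Var [simp]: "up Var = Var"
proof
  show "up Var n = Var n" for n by (cases n) auto
qed

lemma up_subst_tm: "up (\<lambda>n. subst_tm (\<sigma> n) \<tau>) = (\<lambda>n. subst_tm (up \<sigma> n) (up \<tau>))"
proof
  show "up (\<lambda>n. subst_tm (\<sigma> n) \<tau>) n = subst_tm (up \<sigma> n) (up \<tau>)" for n
    by (cases n) (auto simp: subst_tm_subst_tm)
qed

lemma subst_subst: "subst (subst \<phi> \<sigma>) \<tau> = subst \<phi> (\<lambda>n. subst_tm (\<sigma> n) \<tau>)"
  by (induction \<phi> arbitrary: \<sigma> \<tau>) (auto simp: subst_tm_subst_tm up_subst_tm)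

lemma subst_Var [simp]: "subst \<phi> Var = \<phi>"
  by (induction \<phi>) auto

lemma up_cong:
  assumes "\<And>n. Suc n \<in> A \<Longrightarrow> \<sigma> n = \<tau> n" and "n \<in> A"
  shows "up \<sigma> n = up \<tau> n"
  using assms by (cases n) auto

lemma subst_cong: "(\<And>n. n \<in> fv \<phi> \<Longrightarrow> \<sigma> n = \<tau> n) \<Longrightarrow> subst \<phi> \<sigma> = subst \<phi> \<tau>"
proof (induction \<phi> arbitrary: \<sigma> \<tau>)
  case (Eq s t)
  then show ?case by (auto intro: subst_tm_cong)
next
  case (And \<phi> \<psi>)
  then show ?case by (metis UnCI fv.simps(3) subst.simps(3))
next
  case (Or \<phi> \<psi>)
  then show ?case by (metis UnCI fv.simps(4) subst.simps(4))
next
  case (Imp \<phi> \<psi>)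
  then show ?case by (metis UnCI fv.simps(5) subst.simps(5))
next
  case (All \<phi>)
  have "subst \<phi> (up \<sigma>) = subst \<phi> (up \<tau>)"
    using All.prems by (intro All.IH up_cong[where A = "fv \<phi>"]) auto
  then show ?case by simp
next
  case (Ex \<phi>)
  have "subst \<phi> (up \<sigma>) = subst \<phi> (up \<tau>)"
    using Ex.prems by (intro Ex.IH up_cong[where A = "fv \<phi>"]) auto
  then show ?case by simp
qed simp

lemma subst_id: "(\<And>n. n \<in> fv \<phi> \<Longrightarrow> \<sigma> n = Var n) \<Longrightarrow> subst \<phi> \<sigma> = \<phi>"
  using subst_cong[of \<phi> \<sigma> Var] by simp

lemma fv_tm_up: "Suc n \<in> fv_tm (up \<sigma> m) \<longleftrightarrow> (\<exists>k. m = Suc k \<and> n \<in> fv_tm (\<sigma> k))"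
  by (cases m) (auto simp: fv_subst_tm)

lemma fv_subst: "fv (subst \<phi> \<sigma>) = (\<Union>n\<in>fv \<phi>. fv_tm (\<sigma> n))"
  by (induction \<phi> arbitrary: \<sigma>) (force simp: fv_subst_tm fv_tm_up)+

lemma finite_fv_tm: "finite (fv_tm t)"
  by (induction t) auto

lemma finite_fv: "finite (fv \<phi>)"
proof (induction \<phi>)
  case (All \<phi>)
  then show ?case using finite_vimageI[of "fv \<phi>" Suc] by (simp add: vimage_def)
next
  case (Ex \<phi>)
  then show ?case using finite_vimageI[of "fv \<phi>" Suc] by (simp add: vimage_def)
qed (auto simp: finite_fv_tm)

lemma finite_FV: "finite (FV c)"
  by (auto simp: FV_def finite_fv)

lemma ex_fresh: "finite A \<Longrightarrow> \<exists>y :: nat. y \<notin> A"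
  using ex_new_if_finite infinite_UNIV_nat by blast

text \<open>Passes from a named variable to de Bruijn indices: \<open>All (bind x \<phi>)\<close> is
  the usual \<forall>x. \<phi>.\<close>

definition bind :: "nat \<Rightarrow> fm \<Rightarrow> fm" where
  "bind x \<phi> = subst \<phi> (\<lambda>n. if n = x then Var 0 else Var (Suc n))"

lemma inst_bind: "inst (bind x \<phi>) t = subst \<phi> (Var(x := t))"
  by (auto simp: inst_def bind_def subst_subst intro!: subst_cong)

lemma fv_All_bind: "fv (All (bind x \<phi>)) = fv \<phi> - {x}"
  by (auto simp: bind_def fv_subst split: if_splits)

section \<open>Derived rules of Heyting arithmetic\<close>

lemma HA_weaken:
  assumes "HA (\<Gamma> \<leadsto> \<delta>)" and "\<Gamma> |\<subseteq>| \<Gamma>'"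
  shows "HA (\<Gamma>' \<leadsto> \<delta>)"
proof -
  have "\<Gamma>' = \<Gamma> |\<union>| \<Gamma>'" using assms(2) by auto
  then show ?thesis using HA.Logical[OF logical.Wk[of \<Gamma> \<delta> \<Gamma>']] assms(1) by simp
qed

lemma HA_assm: "\<phi> |\<in>| \<Gamma> \<Longrightarrow> HA (\<Gamma> \<leadsto> \<phi>)"
  using HA.Ax[of \<phi> \<Gamma>] by (simp add: finsert_absorb)

lemma HA_cut: "HA (\<Gamma> \<leadsto> \<phi>) \<Longrightarrow> HA (finsert \<phi> \<Gamma> \<leadsto> \<delta>) \<Longrightarrow> HA (\<Gamma> \<leadsto> \<delta>)"
  using HA.Logical[OF logical.Cut[of \<Gamma> \<phi> \<delta>]] by simp

lemma HA_cuts: "(\<And>\<phi>. \<phi> |\<in>| \<Delta> \<Longrightarrow> HA (\<Gamma> \<leadsto> \<phi>)) \<Longrightarrow> HA (\<Delta> |\<union>| \<Gamma> \<leadsto> \<delta>) \<Longrightarrow> HA (\<Gamma> \<leadsto> \<delta>)"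
proof (induction \<Delta>)
  case (insert \<phi> \<Delta>)
  have "HA (\<Delta> |\<union>| \<Gamma> \<leadsto> \<phi>)" by (rule HA_weaken[OF insert.prems(1)]) auto
  then have "HA (\<Delta> |\<union>| \<Gamma> \<leadsto> \<delta>)" by (rule HA_cut) (use insert.prems(2) in simp)
  with insert show ?case by blast
qed simp

lemma HA_ImpI: "HA (finsert \<phi> \<Gamma> \<leadsto> \<psi>) \<Longrightarrow> HA (\<Gamma> \<leadsto> Imp \<phi> \<psi>)"
  using HA.Logical[OF logical.ImpR[of \<phi> \<Gamma> \<psi>]] by simp

lemma HA_ImpE:
  assumes "HA (\<Gamma> \<leadsto> Imp \<phi> \<psi>)" and "HA (\<Gamma> \<leadsto> \<phi>)"
  shows "HA (\<Gamma> \<leadsto> \<psi>)"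
proof (rule HA_cut[OF assms(1)])
  show "HA (finsert (Imp \<phi> \<psi>) \<Gamma> \<leadsto> \<psi>)"
    using HA.Logical[OF logical.ImpL[of \<Gamma> \<phi> \<psi> \<psi>]] assms(2) by (simp add: HA.Ax)
qed

text \<open>Lets antecedent formulas move to the right one at a time, so that an induction over
  \<open>\<Gamma>\<close> with \<open>\<delta>\<close> arbitrary reduces to the empty
  antecedent.\<close>

lemma HA_Imp_iff: "HA (\<Gamma> \<leadsto> Imp \<phi> \<psi>) \<longleftrightarrow> HA (finsert \<phi> \<Gamma> \<leadsto> \<psi>)"
proof
  assume "HA (\<Gamma> \<leadsto> Imp \<phi> \<psi>)"
  then have "HA (finsert \<phi> \<Gamma> \<leadsto> Imp \<phi> \<psi>)" by (rule HA_weaken) auto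
  then show "HA (finsert \<phi> \<Gamma> \<leadsto> \<psi>)" by (rule HA_ImpE) (rule HA.Ax)
qed (rule HA_ImpI)

lemma HA_BotE: "HA (\<Gamma> \<leadsto> Bot) \<Longrightarrow> HA (\<Gamma> \<leadsto> \<delta>)"
  by (erule HA_cut) (use HA.Logical[OF logical.BotL[of \<Gamma> \<delta>]] in simp)

lemma HA_AllI: "HA (\<Gamma> \<leadsto> inst \<phi> (Var y)) \<Longrightarrow> y \<notin> FV (\<Gamma> \<leadsto> All \<phi>) \<Longrightarrow> HA (\<Gamma> \<leadsto> All \<phi>)"
  using HA.Logical[OF logical.AllR[of y \<Gamma> \<phi>]] by simp

lemma HA_AllE:
  assumes "HA (\<Gamma> \<leadsto> All \<phi>)"
  shows "HA (\<Gamma> \<leadsto> inst \<phi> t)"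
proof (rule HA_cut[OF assms])
  show "HA (finsert (All \<phi>) \<Gamma> \<leadsto> inst \<phi> t)"
    using HA.Logical[OF logical.AllL[of \<phi> t \<Gamma> "inst \<phi> t"]] by (simp add: HA.Ax)
qed

lemma HA_All_bindI: "HA (\<Gamma> \<leadsto> \<phi>) \<Longrightarrow> x \<notin> FV (\<Gamma> \<leadsto> Bot) \<Longrightarrow> HA (\<Gamma> \<leadsto> All (bind x \<phi>))"
  by (rule HA_AllI[where y = x]) (auto simp: inst_bind FV_def fv_All_bind simp del: fv.simps(6))

lemma HA_All_bindE: "HA (\<Gamma> \<leadsto> All (bind x \<phi>)) \<Longrightarrow> HA (\<Gamma> \<leadsto> subst \<phi> (Var(x := t)))"
  using HA_AllE[of \<Gamma> "bind x \<phi>" t] by (simp add: inst_bind)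

text \<open>Once the antecedent has been moved into the succedent, no eigenvariable condition stands
  in the way: \<open>x\<close> is generalised and then instantiated with \<open>t\<close>.\<close>

lemma HA_subst:
  "HA (\<Gamma> \<leadsto> \<delta>) \<Longrightarrow> HA ((\<lambda>\<phi>. subst \<phi> (Var(x := t))) |`| \<Gamma> \<leadsto> subst \<delta> (Var(x := t)))"
proof (induction \<Gamma> arbitrary: \<delta>)
  case empty
  then have "HA ({||} \<leadsto> All (bind x \<delta>))" by (rule HA_All_bindI) (simp add: FV_def)
  from HA_All_bindE[OF this, of t] show ?case by (simp del: fun_upd_apply)
next
  case (insert \<phi> \<Gamma>)
  from insert.IH[OF HA_ImpI[OF insert.prems]] show ?case by (simp add: HA_Imp_iff)
qed

lemma HA_induct:
  assumes "HA (\<Gamma> \<leadsto> subst \<phi> (Var(x := Zero)))"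
    and "HA (finsert \<phi> \<Gamma> \<leadsto> subst \<phi> (Var(x := Succ (Var x))))"
    and "x \<notin> FV (\<Gamma> \<leadsto> Bot)"
  shows "HA (\<Gamma> \<leadsto> \<phi>)"
proof -
  let ?B = "bind x \<phi>"
  let ?step = "Imp ?B (subst ?B (Var(0 := Succ (Var 0))))"
  \<comment> \<open>Binding turns \<open>x\<close> into index 0, so the step formula of the
    induction axiom is the bound form of the step in named variables.\<close>
  have step: "?step = bind x (Imp \<phi> (subst \<phi> (Var(x := Succ (Var x)))))"
    by (auto simp: bind_def subst_subst intro!: subst_cong)
  have "HA (\<Gamma> \<leadsto> All ?step)"
    unfolding step by (intro HA_All_bindI HA_ImpI assms)
  moreover have "HA (\<Gamma> \<leadsto> inst ?B Zero)" using assms(1) by (simp add: inst_bind)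
  moreover have "HA ({|inst ?B Zero, All ?step|} |\<union>| \<Gamma> \<leadsto> inst ?B (Var x))"
    by (rule HA_weaken[OF HA.Induction[of ?B "Var x"]]) auto
  ultimately have "HA (\<Gamma> \<leadsto> inst ?B (Var x))"
    by - (rule HA_cuts[of "{|inst ?B Zero, All ?step|}" \<Gamma>], auto)
  then show ?thesis by (simp add: inst_bind)
qed

text \<open>For an empty antecedent this is induction: the successor premise, weakened by
  \<open>\<delta>\<close>, is the induction step. Other antecedents may contain \<open>x\<close> and
  are first absorbed into \<open>\<delta>\<close> as implications.\<close>

lemma HA_case:
  "HA ((\<lambda>\<phi>. subst \<phi> (Var(x := Zero))) |`| \<Gamma> \<leadsto> subst \<delta> (Var(x := Zero))) \<Longrightarrow>
   HA ((\<lambda>\<phi>. subst \<phi> (Var(x := Succ (Var x)))) |`| \<Gamma> \<leadsto> subst \<delta> (Var(x := Succ (Var x)))) \<Longrightarrow>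
   HA (\<Gamma> \<leadsto> \<delta>)"
proof (induction \<Gamma> arbitrary: \<delta>)
  case empty
  have "HA ({|\<delta>|} \<leadsto> subst \<delta> (Var(x := Succ (Var x))))"
    by (rule HA_weaken[where \<Gamma> = "{||}"]) (use empty(2) in \<open>auto simp del: fun_upd_apply\<close>)
  with empty(1) show ?case
    by - (rule HA_induct[where x = x], auto simp: FV_def simp del: fun_upd_apply)
next
  case (insert \<phi> \<Gamma>)
  from insert.prems insert.IH[of "Imp \<phi> \<delta>"] show ?case by (simp add: HA_Imp_iff)
qed

section \<open>Equality reasoning and the arithmetic axioms\<close>

lemma HA_refl: "HA (\<Gamma> \<leadsto> Eq t t)"
  using HA.Logical[OF logical.EqR] by simp

lemma HA_rewrite:
  assumes "HA (\<Gamma> \<leadsto> Eq s t)" and "HA (\<Gamma> \<leadsto> subst \<phi> (Var(z := s)))"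
  shows "HA (\<Gamma> \<leadsto> subst \<phi> (Var(z := t)))"
proof -
  have fin: "finite (fv \<phi> \<union> fv_tm s \<union> fv_tm t)" by (simp add: finite_fv finite_fv_tm)
  obtain x where x: "x \<notin> fv \<phi> \<union> fv_tm s \<union> fv_tm t" using ex_fresh[OF fin] by blast
  obtain y where y: "y \<notin> insert x (fv \<phi> \<union> fv_tm s \<union> fv_tm t)"
    using ex_fresh fin by (metis finite_insert)
  \<comment> \<open>EqL is applied to \<phi>(x) \<Rightarrow> \<phi>(y): identifying
    \<open>y\<close> with \<open>x\<close> makes it an instance of Ax, while substituting
    \<open>s\<close> and \<open>t\<close> gives \<phi>(s), s = t \<Rightarrow> \<phi>(t). Freshness
    confines both substitutions to the terms put for \<open>z\<close>.\<close>
  let ?c = "{|subst \<phi> (Var(z := Var x))|} \<leadsto> subst \<phi> (Var(z := Var y))"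
  have "subst_seq ?c (Var(x := s, y := t)) = ({|subst \<phi> (Var(z := s))|} \<leadsto> subst \<phi> (Var(z := t)))"
    using x y by (auto simp: subst_seq_def subst_subst intro!: subst_cong)
  moreover have "subst_seq ?c (Var(y := Var x))
      = ({|subst \<phi> (Var(z := Var x))|} \<leadsto> subst \<phi> (Var(z := Var x)))"
    using x y by (auto simp: subst_seq_def subst_subst intro!: subst_cong)
  then have "HA (subst_seq ?c (Var(y := Var x)))" by (simp add: HA.Ax)
  ultimately have "HA ({|Eq s t, subst \<phi> (Var(z := s))|} \<leadsto> subst \<phi> (Var(z := t)))"
    using HA.Logical[OF logical.EqL[of x y s t "ant ?c" "con ?c"]] x y by simp
  then have "HA ({|Eq s t, subst \<phi> (Var(z := s))|} |\<union>| \<Gamma> \<leadsto> subst \<phi> (Var(z := t)))"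
    by (rule HA_weaken) auto
  then show ?thesis
    using assms by - (rule HA_cuts[of "{|Eq s t, subst \<phi> (Var(z := s))|}"], auto)
qed

text \<open>Rewrites \<open>z\<close> in z = s, starting from s = s; freshness of \<open>z\<close>
  keeps the other side fixed. The next two lemmas rewrite r = z and Ss = Sz in the same way.\<close>

lemma HA_sym:
  assumes "HA (\<Gamma> \<leadsto> Eq s t)"
  shows "HA (\<Gamma> \<leadsto> Eq t s)"
proof -
  obtain z where "z \<notin> fv_tm s" using ex_fresh[OF finite_fv_tm] by blast
  then have "subst_tm s (Var(z := u)) = s" for u by (rule subst_tm_fresh)
  then show ?thesis using HA_rewrite[OF assms, of "Eq (Var z) s" z] by (simp add: HA_refl)
qed

lemma HA_trans:
  assumes "HA (\<Gamma> \<leadsto> Eq r s)" and "HA (\<Gamma> \<leadsto> Eq s t)"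
  shows "HA (\<Gamma> \<leadsto> Eq r t)"
proof -
  obtain z where "z \<notin> fv_tm r" using ex_fresh[OF finite_fv_tm] by blast
  then have "subst_tm r (Var(z := u)) = r" for u by (rule subst_tm_fresh)
  then show ?thesis using HA_rewrite[OF assms(2), of "Eq r (Var z)" z] assms(1) by simp
qed

lemma HA_Succ_cong:
  assumes "HA (\<Gamma> \<leadsto> Eq s t)"
  shows "HA (\<Gamma> \<leadsto> Eq (Succ s) (Succ t))"
proof -
  obtain z where "z \<notin> fv_tm s" using ex_fresh[OF finite_fv_tm] by blast
  then have "subst_tm s (Var(z := u)) = s" for u by (rule subst_tm_fresh)
  then show ?thesis
    using HA_rewrite[OF assms, of "Eq (Succ s) (Succ (Var z))" z] by (simp add: HA_refl)
qed

text \<open>\<open>\<psi>\<close> is first collapsed to the single variable 0, so that one rewriting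
  replaces all its variables at once.\<close>

lemma HA_rewrite_const:
  assumes "HA (\<Gamma> \<leadsto> Eq s t)" and "HA (\<Gamma> \<leadsto> subst \<psi> (\<lambda>_. s))"
  shows "HA (\<Gamma> \<leadsto> subst \<psi> (\<lambda>_. t))"
  using HA_rewrite[OF assms(1), of "subst \<psi> (\<lambda>_. Var 0)" 0] assms(2) by (simp add: subst_subst)

lemma HA_arith: "arith_axiom (\<Delta> \<leadsto> \<delta>) \<Longrightarrow> \<Delta> |\<subseteq>| \<Gamma> \<Longrightarrow> HA (\<Gamma> \<leadsto> \<delta>)"
  by (rule HA_weaken[OF HA.Arith])

lemma HA_Add_Zero: "HA (\<Gamma> \<leadsto> Eq (Add s Zero) s)"
  by (rule HA_arith[OF arith_axiom.intros(3)]) simp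

lemma HA_Add_Succ: "HA (\<Gamma> \<leadsto> Eq (Add s (Succ t)) (Succ (Add s t)))"
  by (rule HA_arith[OF arith_axiom.intros(4)]) simp

lemma HA_Zero_Succ: "HA (\<Gamma> \<leadsto> Eq Zero (Succ t)) \<Longrightarrow> HA (\<Gamma> \<leadsto> \<delta>)"
  by (rule HA_BotE, rule HA_ImpE, rule HA_arith[OF arith_axiom.intros(1)]) auto

lemma HA_Succ_inj: "HA (\<Gamma> \<leadsto> Eq (Succ s) (Succ t)) \<Longrightarrow> HA (\<Gamma> \<leadsto> Eq s t)"
  by (erule HA_cut) (rule HA_arith[OF arith_axiom.intros(2)], auto)

section \<open>Strong induction\<close>

text \<open>
  \<open>below \<psi> t\<close> is \<open>\<forall>z < t. \<psi>(z)\<close>, written \<open>\<forall>z. \<forall>w. z + Sw = t \<rightarrow> \<psi>(z)\<close>. It is meant for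
  \<open>\<psi>\<close> with a single free variable, whose name is immaterial: \<open>\<psi>(r)\<close> is \<open>subst \<psi> (\<lambda>_. r)\<close>.
\<close>

definition below :: "fm \<Rightarrow> tm \<Rightarrow> fm" where
  "below \<psi> t = All (All (Imp (Eq (Add (Var 1) (Succ (Var 0))) (subst_tm t (\<lambda>n. Var (n + 2))))
    (subst \<psi> (\<lambda>_. Var 1))))"

text \<open>Index 0 is w and index 1 is z. At most z occurs in the instance of
  \<open>\<psi>\<close>, so a substitution reaches only the limit \<open>t\<close>.\<close>

lemma subst_below: "subst (below \<psi> t) \<sigma> = below \<psi> (subst_tm t \<sigma>)"
  by (auto simp: below_def subst_subst subst_tm_subst_tm intro!: subst_tm_cong)

lemma fv_below: "fv (below \<psi> t) = fv_tm t"
  by (auto simp: below_def fv_subst fv_subst_tm)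

lemma HA_below_E:
  assumes "HA (\<Gamma> \<leadsto> below \<psi> t)" and "HA (\<Gamma> \<leadsto> Eq (Add r (Succ q)) t)"
  shows "HA (\<Gamma> \<leadsto> subst \<psi> (\<lambda>_. r))"
proof -
  have "HA (\<Gamma> \<leadsto> All (Imp (Eq (Add (subst_tm r (\<lambda>n. Var (Suc n))) (Succ (Var 0)))
      (subst_tm t (\<lambda>n. Var (Suc n)))) (subst \<psi> (\<lambda>_. subst_tm r (\<lambda>n. Var (Suc n))))))"
    using HA_AllE[OF assms(1)[unfolded below_def], of r]
    by (simp add: inst_def subst_subst subst_tm_subst_tm)
  from HA_AllE[OF this, of q]
  have "HA (\<Gamma> \<leadsto> Imp (Eq (Add r (Succ q)) t) (subst \<psi> (\<lambda>_. r)))"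
    by (simp add: inst_def subst_subst subst_tm_subst_tm)
  then show ?thesis using assms(2) by (rule HA_ImpE)
qed

lemma HA_below_I:
  assumes "\<And>a b. a \<noteq> b \<Longrightarrow> {a, b} \<inter> (FV (\<Gamma> \<leadsto> Bot) \<union> fv_tm t) = {} \<Longrightarrow>
    HA (finsert (Eq (Add (Var a) (Succ (Var b))) t) \<Gamma> \<leadsto> subst \<psi> (\<lambda>_. Var a))"
  shows "HA (\<Gamma> \<leadsto> below \<psi> t)"
proof -
  have fin: "finite (FV (\<Gamma> \<leadsto> Bot) \<union> fv_tm t)" by (simp add: finite_FV finite_fv_tm)
  obtain a where a: "a \<notin> FV (\<Gamma> \<leadsto> Bot) \<union> fv_tm t" using ex_fresh[OF fin] by blast
  obtain b where b: "b \<notin> insert a (FV (\<Gamma> \<leadsto> Bot) \<union> fv_tm t)"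
    using ex_fresh fin by (metis finite_insert)
  \<comment> \<open>\<open>?B r\<close> is what remains of \<open>below \<psi> t\<close> inside the
    quantifier on w once z is instantiated with \<open>r\<close>; hence all terms are shifted by
    one.\<close>
  let ?B = "\<lambda>r. Imp (Eq (Add (subst_tm r (\<lambda>n. Var (Suc n))) (Succ (Var 0)))
    (subst_tm t (\<lambda>n. Var (Suc n)))) (subst \<psi> (\<lambda>_. subst_tm r (\<lambda>n. Var (Suc n))))"
  have "HA (\<Gamma> \<leadsto> inst (?B (Var a)) (Var b))"
    using assms[of a b] a b by (simp add: inst_def subst_subst subst_tm_subst_tm HA_Imp_iff)
  then have "HA (\<Gamma> \<leadsto> All (?B (Var a)))"
    using a b by (intro HA_AllI[where y = b]) (auto simp: FV_def fv_subst fv_subst_tm)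
  then have "HA (\<Gamma> \<leadsto> inst (All (Imp (Eq (Add (Var 1) (Succ (Var 0)))
      (subst_tm t (\<lambda>n. Var (n + 2)))) (subst \<psi> (\<lambda>_. Var 1)))) (Var a))"
    by (simp add: inst_def subst_subst subst_tm_subst_tm)
  then show ?thesis
    unfolding below_def using a fv_below[of \<psi> t]
    by (intro HA_AllI[where y = a]) (auto simp: FV_def below_def)
qed

text \<open>An element below 0 would give 0 = S(a + b), which the axiom 0 \<noteq> St
  refutes.\<close>

lemma HA_below_Zero: "HA (\<Gamma> \<leadsto> below \<psi> Zero)"
proof (rule HA_below_I)
  fix a b
  let ?\<Gamma> = "finsert (Eq (Add (Var a) (Succ (Var b))) Zero) \<Gamma>"
  have "HA (?\<Gamma> \<leadsto> Eq Zero (Add (Var a) (Succ (Var b))))" by (rule HA_sym[OF HA_assm]) simp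
  from HA_trans[OF this HA_Add_Succ]
  show "HA (?\<Gamma> \<leadsto> subst \<psi> (\<lambda>_. Var a))" by (rule HA_Zero_Succ)
qed

lemma HA_Add_Succ_Succ:
  "HA (\<Gamma> \<leadsto> Eq (Add r (Succ q)) t) \<Longrightarrow> HA (\<Gamma> \<leadsto> Eq (Add r (Succ (Succ q))) (Succ t))"
  using HA_trans[OF HA_Add_Succ HA_Succ_cong] .

text \<open>If a + Sb = t then a + SSb = St: the witness of the inequality grows by one.\<close>

lemma HA_below_mono:
  assumes "HA (\<Gamma> \<leadsto> below \<psi> (Succ t))"
  shows "HA (\<Gamma> \<leadsto> below \<psi> t)"
proof (rule HA_below_I)
  fix a b
  let ?\<Gamma> = "finsert (Eq (Add (Var a) (Succ (Var b))) t) \<Gamma>"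
  have "HA (?\<Gamma> \<leadsto> below \<psi> (Succ t))" using assms by (rule HA_weaken) auto
  moreover have "HA (?\<Gamma> \<leadsto> Eq (Add (Var a) (Succ (Succ (Var b)))) (Succ t))"
    by (intro HA_Add_Succ_Succ HA.Ax)
  ultimately show "HA (?\<Gamma> \<leadsto> subst \<psi> (\<lambda>_. Var a))" by (rule HA_below_E)
qed

lemma HA_below_last: "HA (\<Gamma> \<leadsto> below \<psi> (Succ t)) \<Longrightarrow> HA (\<Gamma> \<leadsto> subst \<psi> (\<lambda>_. t))"
  by (erule HA_below_E[where q = Zero]) (rule HA_trans[OF HA_Add_Succ HA_Succ_cong[OF HA_Add_Zero]])

text \<open>From a + Sb = St follows a + b = t, so either b = 0 and a = t, or b is a successor and a
  < t.\<close>

lemma HA_below_Succ: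
  assumes "HA (\<Gamma> \<leadsto> below \<psi> t)" and "HA (\<Gamma> \<leadsto> subst \<psi> (\<lambda>_. t))"
  shows "HA (\<Gamma> \<leadsto> below \<psi> (Succ t))"
proof (rule HA_below_I)
  fix a b
  assume ab: "a \<noteq> b" "{a, b} \<inter> (FV (\<Gamma> \<leadsto> Bot) \<union> fv_tm (Succ t)) = {}"
  then have t: "subst_tm t (Var(b := u)) = t" for u by (intro subst_tm_fresh) auto
  let ?le = "\<lambda>q. Imp (Eq (Add (Var a) q) t) (subst \<psi> (\<lambda>_. Var a))"
  \<comment> \<open>Induction on \<open>b\<close> serves as a case distinction: zero uses \<psi>(t),
    a successor uses \<open>below \<psi> t\<close>.\<close>
  have le: "HA (\<Gamma> \<leadsto> ?le (Var b))"
  proof (rule HA_induct[where x = b])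
    let ?\<Gamma> = "finsert (Eq (Add (Var a) Zero) t) \<Gamma>"
    have "HA (?\<Gamma> \<leadsto> Eq t (Add (Var a) Zero))" by (rule HA_sym[OF HA_assm]) simp
    then have "HA (?\<Gamma> \<leadsto> Eq t (Var a))" using HA_Add_Zero by (rule HA_trans)
    moreover have "HA (?\<Gamma> \<leadsto> subst \<psi> (\<lambda>_. t))" using assms(2) by (rule HA_weaken) auto
    ultimately have "HA (\<Gamma> \<leadsto> ?le Zero)" by (rule HA_ImpI[OF HA_rewrite_const])
    then show "HA (\<Gamma> \<leadsto> subst (?le (Var b)) (Var(b := Zero)))"
      using ab(1) by (simp add: subst_subst t)
  next
    let ?\<Gamma> = "finsert (Eq (Add (Var a) (Succ (Var b))) t) (finsert (?le (Var b)) \<Gamma>)"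
    have "HA (?\<Gamma> \<leadsto> below \<psi> t)" using assms(1) by (rule HA_weaken) auto
    moreover have "HA (?\<Gamma> \<leadsto> Eq (Add (Var a) (Succ (Var b))) t)" by (rule HA_assm) simp
    ultimately have "HA (finsert (?le (Var b)) \<Gamma> \<leadsto> ?le (Succ (Var b)))"
      by (intro HA_ImpI HA_below_E)
    then show "HA (finsert (?le (Var b)) \<Gamma> \<leadsto> subst (?le (Var b)) (Var(b := Succ (Var b))))"
      using ab(1) by (simp add: subst_subst t)
  next
    show "b \<notin> FV (\<Gamma> \<leadsto> Bot)" using ab(2) by auto
  qed
  let ?\<Gamma> = "finsert (Eq (Add (Var a) (Succ (Var b))) (Succ t)) \<Gamma>"
  from le have "HA (?\<Gamma> \<leadsto> ?le (Var b))" by (rule HA_weaken) auto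
  moreover have "HA (?\<Gamma> \<leadsto> Eq (Add (Var a) (Succ (Var b))) (Succ t))" by (rule HA_assm) simp
  from HA_trans[OF HA_sym[OF HA_Add_Succ] this]
  have "HA (?\<Gamma> \<leadsto> Eq (Add (Var a) (Var b)) t)" by (rule HA_Succ_inj)
  ultimately show "HA (?\<Gamma> \<leadsto> subst \<psi> (\<lambda>_. Var a))" by (rule HA_ImpE)
qed

text \<open>Ordinary induction on \<open>x\<close> proves \<open>below \<psi> (Var x)\<close>; in
  the step the assumption supplies the one new value \<psi>(x).\<close>

lemma HA_strong_induct:
  assumes "HA ({|below \<psi> (Var x)|} \<leadsto> subst \<psi> (\<lambda>_. Var x))"
  shows "HA ({||} \<leadsto> subst \<psi> (\<lambda>_. Var x))"
proof -
  have "HA ({||} \<leadsto> below \<psi> (Var x))"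
    by (rule HA_induct[where x = x])
      (auto simp: subst_below FV_def HA_below_Zero intro!: HA_below_Succ assms HA.Ax)
  then show ?thesis using assms by (rule HA_cut)
qed

section \<open>Closing sequents\<close>

text \<open>\<open>\<theta>\<close> is the iterated implication from the members of
  \<open>\<Gamma>\<close> to \<open>\<delta>\<close>. It is characterised by when it is provable,
  since a finite set fixes no order of its members.\<close>

lemma ex_Imp_fm: "\<exists>\<theta>. \<forall>\<Psi>. HA (\<Psi> \<leadsto> \<theta>) \<longleftrightarrow> HA (\<Gamma> |\<union>| \<Psi> \<leadsto> \<delta>)"
proof (induction \<Gamma> arbitrary: \<delta>)
  case empty
  then show ?case by auto
next
  case (insert \<phi> \<Gamma>)
  from insert.IH[of "Imp \<phi> \<delta>"] show ?case by (simp add: HA_Imp_iff)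
qed

text \<open>\<open>\<psi>\<close> quantifies universally over the variables in \<open>V\<close>
  other than \<open>x\<close>. Passing to \<open>\<theta>\<close> only instantiates; passing back
  generalises, and the bound on the free variables of \<open>\<Psi>\<close> secures the
  eigenvariable conditions.\<close>

lemma ex_closure:
  assumes "finite V" and "fv \<theta> \<subseteq> insert x V"
  shows "\<exists>\<psi>. fv \<psi> \<subseteq> {x} \<and> (\<forall>\<Psi>. HA (\<Psi> \<leadsto> \<psi>) \<longrightarrow> HA (\<Psi> \<leadsto> \<theta>)) \<and>
    (\<forall>\<Psi>. FV (\<Psi> \<leadsto> Bot) \<subseteq> {x} \<longrightarrow> HA (\<Psi> \<leadsto> \<theta>) \<longrightarrow> HA (\<Psi> \<leadsto> \<psi>))"
  using assms
proof (induction V arbitrary: \<theta> rule: finite_induct)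
  case empty
  then show ?case by auto
next
  case (insert y V)
  show ?case
  proof (cases "y = x")
    case True
    then show ?thesis using insert by auto
  next
    case False
    have "fv (All (bind y \<theta>)) \<subseteq> insert x V"
      using insert.prems by (auto simp: fv_All_bind simp del: fv.simps)
    from insert.IH[OF this] obtain \<psi> where \<psi>: "fv \<psi> \<subseteq> {x}"
      "\<And>\<Psi>. HA (\<Psi> \<leadsto> \<psi>) \<Longrightarrow> HA (\<Psi> \<leadsto> All (bind y \<theta>))"
      "\<And>\<Psi>. FV (\<Psi> \<leadsto> Bot) \<subseteq> {x} \<Longrightarrow> HA (\<Psi> \<leadsto> All (bind y \<theta>)) \<Longrightarrow> HA (\<Psi> \<leadsto> \<psi>)"
      by blast
    have "HA (\<Psi> \<leadsto> \<theta>)" if "HA (\<Psi> \<leadsto> \<psi>)" for \<Psi>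
      using HA_All_bindE[OF \<psi>(2)[OF that], of "Var y"] by simp
    moreover have "HA (\<Psi> \<leadsto> \<psi>)" if "FV (\<Psi> \<leadsto> Bot) \<subseteq> {x}" "HA (\<Psi> \<leadsto> \<theta>)" for \<Psi>
      using that False by (intro \<psi>(3) HA_All_bindI) auto
    ultimately show ?thesis using \<psi>(1) by blast
  qed
qed

section \<open>Stacks as induction hypotheses\<close>

primrec hyp_bound :: "polarity \<Rightarrow> nat \<Rightarrow> tm" where
  "hyp_bound Minus x = Var x"
| "hyp_bound Plus x = Succ (Var x)"

text \<open>A relation and not a function of the stack: the \<open>\<psi>\<close> chosen at a label
  has to outlive changes of polarity, whereas recomputing it from the altered hypotheses would give
  another formula.\<close>

inductive interp :: "stack \<Rightarrow> fm fset \<Rightarrow> bool" where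
  Nil: "interp [] {||}"
| Snoc: "interp \<Lambda> \<Phi> \<Longrightarrow> HA (finsert (subst \<psi> (\<lambda>_. Var x)) \<Phi> |\<union>| \<Gamma> \<leadsto> \<delta>)
    \<Longrightarrow> interp (\<Lambda> @ [Label x p (\<Gamma> \<leadsto> \<delta>)]) (finsert (below \<psi> (hyp_bound p x)) \<Phi>)"

inductive_cases interp_SnocE: "interp (\<Lambda> @ [l]) \<Phi>"

text \<open>Each hypothesis has at most its tracked variable free. With the side conditions of
  \<open>SHA\<close> this keeps eigenvariables, and the variables eliminated by EqL, out of
  \<open>\<Phi>\<close>.\<close>

lemma FV_interp: "interp \<Lambda> \<Phi> \<Longrightarrow> FV (\<Phi> \<leadsto> Bot) \<subseteq> Vars \<Lambda>"
proof (induction rule: interp.induct)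
  case (Snoc \<Lambda> \<Phi> \<psi> x \<Gamma> \<delta> p)
  then show ?case by (cases p) (auto simp: FV_def Vars_def fv_below)
qed (simp add: FV_def)

lemma interp_append:
  "interp (\<Lambda> @ \<Lambda>') \<Phi> \<Longrightarrow> \<exists>\<Phi>'. interp \<Lambda> \<Phi>' \<and> \<Phi>' |\<subseteq>| \<Phi>"
proof (induction \<Lambda>' arbitrary: \<Phi> rule: rev_induct)
  case (snoc l \<Lambda>')
  from snoc.prems[unfolded append_assoc[symmetric]] obtain \<Phi>'
    where "interp (\<Lambda> @ \<Lambda>') \<Phi>'" "\<Phi>' |\<subseteq>| \<Phi>" by (rule interp_SnocE) blast
  with snoc.IH show ?case by blast
qed auto

text \<open>The first clause, that the new hypotheses are at least as strong, preserves the
  requirement on labels higher up. The second serves Case: putting Sx for x turns the limit x of a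
  negative label into Sx, the limit of a positive one.\<close>

lemma interp_plus_at:
  "interp \<Lambda> \<Phi> \<Longrightarrow> \<exists>\<Phi>'. interp (plus_at x \<Lambda>) \<Phi>' \<and> (\<forall>\<phi>\<in>fset \<Phi>. HA (\<Phi>' \<leadsto> \<phi>)) \<and>
    (\<forall>\<phi>\<in>fset \<Phi>'. HA ((\<lambda>\<phi>. subst \<phi> (Var(x := Succ (Var x)))) |`| \<Phi> \<leadsto> \<phi>))"
proof (induction rule: interp.induct)
  case Nil
  have "plus_at x [] = []" by (simp add: plus_at_def)
  then show ?case using interp.Nil by auto
next
  case (Snoc \<Lambda> \<Phi> \<psi> y \<Gamma> \<delta> p)
  let ?s = "\<lambda>\<phi>. subst \<phi> (Var(x := Succ (Var x)))"
  from Snoc.IH obtain \<Phi>' where \<Phi>': "interp (plus_at x \<Lambda>) \<Phi>'"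
    and down: "\<And>\<phi>. \<phi> |\<in>| \<Phi> \<Longrightarrow> HA (\<Phi>' \<leadsto> \<phi>)"
    and up: "\<And>\<phi>. \<phi> |\<in>| \<Phi>' \<Longrightarrow> HA (?s |`| \<Phi> \<leadsto> \<phi>)"
    by blast
  define p' where "p' = (if y = x then Plus else p)"
  let ?h = "below \<psi> (hyp_bound p y)" and ?h' = "below \<psi> (hyp_bound p' y)"
  have "HA (\<Phi> |\<union>| (finsert (subst \<psi> (\<lambda>_. Var y)) \<Phi>' |\<union>| \<Gamma>) \<leadsto> \<delta>)"
    using Snoc.hyps(2) by (rule HA_weaken) auto
  then have "HA (finsert (subst \<psi> (\<lambda>_. Var y)) \<Phi>' |\<union>| \<Gamma> \<leadsto> \<delta>)"
    by (rule HA_cuts[rotated]) (auto intro: HA_weaken[OF down])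
  from interp.Snoc[OF \<Phi>' this, of p']
  have "interp (plus_at x (\<Lambda> @ [Label y p (\<Gamma> \<leadsto> \<delta>)])) (finsert ?h' \<Phi>')"
    by (auto simp: plus_at_def p'_def)
  moreover have "HA (finsert ?h' \<Phi>' \<leadsto> ?h)"
    by (cases p) (simp_all add: p'_def HA.Ax HA_below_mono[OF HA.Ax])
  then have "\<forall>\<phi>\<in>fset (finsert ?h \<Phi>). HA (finsert ?h' \<Phi>' \<leadsto> \<phi>)"
    by (auto intro: HA_weaken[OF down])
  \<comment> \<open>A label of \<open>x\<close> that was positive before gets the limit SSx from the
    substitution, which monotonicity lowers to Sx.\<close>
  moreover have "HA (?s |`| finsert ?h \<Phi> \<leadsto> ?h')"
    by (cases p) (simp_all add: p'_def subst_below HA.Ax HA_below_mono[OF HA.Ax])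
  then have "\<forall>\<phi>\<in>fset (finsert ?h' \<Phi>'). HA (?s |`| finsert ?h \<Phi> \<leadsto> \<phi>)"
    by (auto intro: HA_weaken[OF up])
  ultimately show ?case by blast
qed

section \<open>Soundness of the rules under the reading of stacks\<close>

lemma logical_add_context:
  assumes "logical ps E c" and "E \<inter> FV (\<Phi> \<leadsto> Bot) = {}" and "FV (\<Phi> \<leadsto> Bot) \<subseteq> FV c"
  shows "logical (map (\<lambda>p. \<Phi> |\<union>| ant p \<leadsto> con p) ps) E (\<Phi> |\<union>| ant c \<leadsto> con c)"
  using assms
proof (cases rule: logical.cases)
  case (EqL x y s t \<Gamma> \<delta> \<Gamma>' \<delta>')
  have "subst_seq (\<Gamma> \<leadsto> \<delta>) (Var(x := s, y := t)) = (\<Gamma>' \<leadsto> \<delta>')" by fact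
  \<comment> \<open>EqL eliminates \<open>x\<close> and \<open>y\<close> from its conclusion, whose
    free variables include those of \<open>\<Phi>\<close>; hence both substitutions of the rule
    leave \<open>\<Phi>\<close> unchanged.\<close>
  then have "x \<notin> FV (\<Gamma>' \<leadsto> \<delta>')" "y \<notin> FV (\<Gamma>' \<leadsto> \<delta>')"
    using EqL by (auto simp: subst_seq_def FV_def fv_subst split: if_splits)
  then have fresh: "x \<notin> FV (\<Phi> \<leadsto> Bot)" "y \<notin> FV (\<Phi> \<leadsto> Bot)"
    using assms(3) EqL by (auto simp: FV_def)
  then have id: "(\<lambda>\<phi>. subst \<phi> (Var(x := s, y := t))) |`| \<Phi> = \<Phi>"
    "(\<lambda>\<phi>. subst \<phi> (Var(y := Var x))) |`| \<Phi> = \<Phi>"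
    by (auto simp: FV_def intro!: fset.map_ident_strong subst_id)
  show ?thesis
    using logical.EqL[of x y s t "\<Phi> |\<union>| \<Gamma>" \<delta> "\<Phi> |\<union>| \<Gamma>'" \<delta>'] EqL id
    by (auto simp: subst_seq_def fimage_funion)
next
  case (AllR y \<Gamma> \<phi>)
  then show ?thesis
    using logical.AllR[of y "\<Phi> |\<union>| \<Gamma>" \<phi>] assms(2) by (auto simp: FV_def)
next
  case (ExL y \<phi> \<Gamma> \<delta>)
  then show ?thesis
    using logical.ExL[of y \<phi> "\<Phi> |\<union>| \<Gamma>" \<delta>] assms(2) by (auto simp: FV_def)
next
  case (Wk \<Gamma> \<delta> \<Gamma>')
  then show ?thesis
    using logical.Wk[of "\<Phi> |\<union>| \<Gamma>" \<delta> \<Gamma>'] by (simp add: funion_assoc)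
qed (auto intro: logical.intros)

text \<open>Induction on the derivation for all readings \<open>\<Phi>\<close> at once: Comp needs
  its premise under an extended reading, Case needs its successor premise under a strengthened
  one.\<close>

lemma SHA_interp: "SHA \<Lambda> c \<Longrightarrow> interp \<Lambda> \<Phi> \<Longrightarrow> HA (\<Phi> |\<union>| ant c \<leadsto> con c)"
proof (induction arbitrary: \<Phi> rule: SHA.induct)
  case (Logical ps E c \<Lambda>)
  have "FV (\<Phi> \<leadsto> Bot) \<subseteq> Vars \<Lambda>" using Logical.prems by (rule FV_interp)
  moreover have "Vars \<Lambda> \<subseteq> occurring \<Lambda>" by (auto simp: Vars_def occurring_def)
  ultimately have "logical (map (\<lambda>p. \<Phi> |\<union>| ant p \<leadsto> con p) ps) E (\<Phi> |\<union>| ant c \<leadsto> con c)"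
    using Logical.hyps by (intro logical_add_context) (auto simp: well_formed_def)
  then show ?case by (rule HA.Logical) (use Logical in auto)
next
  case (Ax \<delta> \<Gamma>)
  then show ?case by (simp add: HA.Ax)
next
  case (Arith \<Gamma> \<delta> \<Gamma>')
  then show ?case by (auto intro: HA_arith)
next
  case (Comp \<Lambda> x c)
  \<comment> \<open>The hypotheses \<open>\<Phi>\<close> of the lower labels become part of
    \<open>\<theta>\<close>, so that the strong induction can run without a context.\<close>
  obtain \<theta> where \<theta>: "\<And>\<Psi>. HA (\<Psi> \<leadsto> \<theta>) \<longleftrightarrow> HA ((\<Phi> |\<union>| ant c) |\<union>| \<Psi> \<leadsto> con c)"
    using ex_Imp_fm by blast
  obtain \<psi> where \<psi>: "fv \<psi> \<subseteq> {x}" "\<And>\<Psi>. HA (\<Psi> \<leadsto> \<psi>) \<Longrightarrow> HA (\<Psi> \<leadsto> \<theta>)"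
    "\<And>\<Psi>. FV (\<Psi> \<leadsto> Bot) \<subseteq> {x} \<Longrightarrow> HA (\<Psi> \<leadsto> \<theta>) \<Longrightarrow> HA (\<Psi> \<leadsto> \<psi>)"
    using ex_closure[OF finite_fv, of \<theta> x \<theta>] by blast
  have [simp]: "subst \<psi> (\<lambda>_. Var x) = \<psi>" using \<psi>(1) by (intro subst_id) auto
  have "HA ({|\<psi>|} \<leadsto> \<theta>)" by (intro \<psi>(2) HA.Ax)
  then have "HA (finsert \<psi> \<Phi> |\<union>| ant c \<leadsto> con c)" by (simp add: \<theta>)
  then have "interp (\<Lambda> @ [Label x Minus c]) (finsert (below \<psi> (Var x)) \<Phi>)"
    using interp.Snoc[OF Comp.prems, of \<psi> x "ant c" "con c" Minus] by simp
  \<comment> \<open>With \<open>\<Phi>\<close> and the antecedent inside \<open>\<theta>\<close>,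
    only the new hypothesis remains on the left. At most \<open>x\<close> is free in it, so
    \<open>\<theta>\<close> may be generalised to \<open>\<psi>\<close>, which is the premise of
    strong induction.\<close>
  from Comp.IH[OF this] have "HA ({|below \<psi> (Var x)|} \<leadsto> \<theta>)" by (simp add: \<theta>)
  then have "HA ({|below \<psi> (Var x)|} \<leadsto> \<psi>)" by (intro \<psi>(3)) (auto simp: FV_def fv_below)
  then have "HA ({||} \<leadsto> \<psi>)" using HA_strong_induct[of \<psi> x] by simp
  from \<psi>(2)[OF this] show ?case by (simp add: \<theta>)
next
  case (Bud \<Lambda> x c)
  from Bud.prems obtain \<Phi>' \<psi> where \<Phi>: "\<Phi> = finsert (below \<psi> (Succ (Var x))) \<Phi>'"
    and use: "HA (finsert (subst \<psi> (\<lambda>_. Var x)) \<Phi>' |\<union>| ant c \<leadsto> con c)"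
    by (auto elim: interp_SnocE)
  \<comment> \<open>The limit Sx, in place of x, is what admits the instance z = x.\<close>
  have "HA (\<Phi> |\<union>| ant c \<leadsto> subst \<psi> (\<lambda>_. Var x))"
    unfolding \<Phi> by (intro HA_below_last HA_assm) simp
  then show ?case by (rule HA_cut) (rule HA_weaken[OF use], auto simp: \<Phi>)
next
  case (Pop \<Lambda> c \<Lambda>')
  then obtain \<Phi>' where "interp \<Lambda> \<Phi>'" "\<Phi>' |\<subseteq>| \<Phi>" using interp_append by blast
  from HA_weaken[OF Pop.IH[OF this(1)]] this(2) show ?case by blast
next
  case (Case \<Lambda> c x)
  let ?s = "\<lambda>t \<phi>. subst \<phi> (Var(x := t))"
  obtain \<Phi>' where \<Phi>': "interp (plus_at x \<Lambda>) \<Phi>'"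
    and up: "\<And>\<phi>. \<phi> |\<in>| \<Phi>' \<Longrightarrow> HA (?s (Succ (Var x)) |`| \<Phi> \<leadsto> \<phi>)"
    using interp_plus_at[OF Case.prems] by meson
  \<comment> \<open>The zero premise no longer contains \<open>x\<close>, so substituting 0 for
    \<open>x\<close> once more changes only \<open>\<Phi>\<close>.\<close>
  have idem: "?s Zero (?s Zero \<phi>) = ?s Zero \<phi>" for \<phi>
    by (auto simp: subst_subst intro!: subst_cong)
  have "HA (?s Zero |`| \<Phi> |\<union>| ?s Zero |`| ant c \<leadsto> ?s Zero (con c))"
    using HA_subst[OF Case.IH(1)[OF Case.prems], of x Zero]
    by (simp add: subst_seq_def fimage_funion fset.map_comp comp_def idem del: fun_upd_apply)
  \<comment> \<open>The successor premise is read with \<open>\<Phi>'\<close>, which the cuts below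
    replace by \<Phi>[Sx/x]. Both premises then fit a case distinction on the whole antecedent,
    hypotheses included.\<close>
  moreover have "HA (\<Phi>' |\<union>| (?s (Succ (Var x)) |`| \<Phi> |\<union>| ?s (Succ (Var x)) |`| ant c)
      \<leadsto> ?s (Succ (Var x)) (con c))"
    by (rule HA_weaken[OF Case.IH(2)[OF \<Phi>', unfolded subst_seq_def sequent.sel]]) auto
  then have "HA (?s (Succ (Var x)) |`| \<Phi> |\<union>| ?s (Succ (Var x)) |`| ant c
      \<leadsto> ?s (Succ (Var x)) (con c))"
    by (rule HA_cuts[rotated]) (auto intro: HA_weaken[OF up])
  ultimately show ?case by - (rule HA_case[where x = x], simp_all add: fimage_funion del: fun_upd_apply)
qed

theorem theorem4p3:
  fixes \<Gamma> :: "fm fset" and \<delta> :: fm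
  assumes "SHA [] (\<Gamma> \<leadsto> \<delta>)"
  shows "HA (\<Gamma> \<leadsto> \<delta>)"
  using SHA_interp[OF assms interp.Nil] by simp

end
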